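(* Let $p$ be an odd prime. If $\rho$ is a palindrome in base $b=p^2+1$ consisting entirely of the digits $0$ and $1$, then $2p^2\rho\in\mathbb{V}_{p^2+1}$.
   Context: Natural numbers are positive integers. Every natural number $n$ has a unique base $b$ representation ($b\ge 2$) $n=a_0+a_1b+\cdots+a_{L-1}b^{L-1}$ with $L\ge 1$, integers $0\le a_i<b$ and $a_{L-1}\ne 0$. The digit reversal of $n$ in base $b$ is $r_b(n)=a_{L-1}+a_{L-2}b+\cdots+a_0b^{L-1}$. A natural number $n$ is a palindrome in base $b$ if $n=r_b(n)$; it consists entirely of the digits $0$ and $1$ if every $a_i\in\{0,1\}$. The function $v$ on natural numbers: if $n=p_1^{\varepsilon_1}\cdots p_s^{\varepsilon_s}q_1\cdots q_t$ with $s,t\ge 0$, integers $\varepsilon_i\ge 2$ and distinct primes $p_1,\dots,p_s,q_1,\dots,q_t$, then $v(n)=\sum_{i=1}^s(p_i+\varepsilon_i)+\sum_{j=1}^t q_j$ (so $v(1)=0$). A natural number $n$ is a $v$-palindrome in base $b$ if (i) $b\nmid n$, (ii) $n\ne r_b(n)$, and (iii) $v(n)=v(r_b(n))$. The set of $v$-palindromes in base $b$ is denoted $\mathbb{V}_b$. *)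

theory Defs
  imports "HOL-Computational_Algebra.Computational_Algebra"
begin

text \<open>Digit lists have the least significant digit first, so that \<open>horner_sum id b\<close> maps
  the list \<open>[a\<^sub>0, \<dots>, a\<^sub>k]\<close> to the number \<open>a\<^sub>0 + a\<^sub>1 b + \<dots> + a\<^sub>k b\<^sup>k\<close>. For \<open>b < 2\<close> the
  value is a dummy that only ensures termination.\<close>

function base_digits :: "nat \<Rightarrow> nat \<Rightarrow> nat list" where
  "base_digits b n = (if b < 2 \<or> n = 0 then [] else n mod b # base_digits b (n div b))"
  by pat_completeness auto
termination
  by (relation "measure snd") auto

declare base_digits.simps [simp del]

lemma base_digits_iff:
  assumes "2 \<le> b" and "0 < n"
  shows "base_digits b n = as \<longleftrightarrow>
    as \<noteq> [] \<and> (\<forall>a\<in>set as. a < b) \<and> last as \<noteq> 0 \<and> n = horner_sum id b as"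
  using assms(2)
proof (induction n arbitrary: as rule: less_induct)
  case (less n)
  have step: "base_digits b n = n mod b # base_digits b (n div b)"
    using assms(1) less.prems by (subst base_digits.simps) simp
  show ?case
  proof (cases as)
    case Nil
    then show ?thesis using step by simp
  next
    case (Cons a as')
    have split: "n = a + b * m \<longleftrightarrow> n mod b = a \<and> n div b = m" if "a < b" for m
      using that by auto
    have mod: "n mod b < b" using assms(1) by simp
    show ?thesis
    proof (cases "n div b = 0")
      case True
      have nil: "base_digits b (n div b) = []"
        using True by (subst base_digits.simps) simp
      have zero: "horner_sum id b as' \<noteq> 0" if "as' \<noteq> []" "last as' \<noteq> 0"
        using that assms(1) by (induction as') (auto split: if_splits)
      show ?thesis
        using Cons step nil zero split[of "horner_sum id b as'"] mod True less.prems
        by (cases "as' = []") (auto simp: id_def)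
    next
      case False
      have "n div b < n" using assms(1) less.prems by simp
      with False have IH: "base_digits b (n div b) = as' \<longleftrightarrow>
        as' \<noteq> [] \<and> (\<forall>a\<in>set as'. a < b) \<and> last as' \<noteq> 0 \<and> n div b = horner_sum id b as'"
        using less.IH by (simp add: id_def)
      show ?thesis
        using Cons step IH split[of "horner_sum id b as'"] mod False
        by (cases "as' = []") (auto simp: id_def)
    qed
  qed
qed

definition digit_reversal :: "nat \<Rightarrow> nat \<Rightarrow> nat" where
  "digit_reversal b n = horner_sum id b (rev (base_digits b n))"

definition palindrome :: "nat \<Rightarrow> nat \<Rightarrow> bool" where
  "palindrome b n \<longleftrightarrow> 0 < n \<and> n = digit_reversal b n"

definition digits_zero_one :: "nat \<Rightarrow> nat \<Rightarrow> bool" where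
  "digits_zero_one b n \<longleftrightarrow> set (base_digits b n) \<subseteq> {0, 1}"

text \<open>Primes occurring to the first power contribute only themselves, without their exponent.\<close>

definition v :: "nat \<Rightarrow> nat" where
  "v n = (\<Sum>p\<in>prime_factors n. if multiplicity p n = 1 then p else p + multiplicity p n)"

definition v_palindromes :: "nat \<Rightarrow> nat set" where
  "v_palindromes b =
    {n. 0 < n \<and> \<not> b dvd n \<and> n \<noteq> digit_reversal b n \<and> v n = v (digit_reversal b n)}"

end

theory Submission
  imports Defs
begin

text \<open>
  Put \<open>b = p\<^sup>2 + 1\<close>. Then \<open>2p\<^sup>2 = (b - 2) + b\<close> has the two digits \<open>b - 2\<close> and \<open>1\<close>, and the
  same digits in reverse order give \<open>1 + (b - 2) b = (b - 1)\<^sup>2 = p\<^sup>4\<close>. When a two-digit number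
  whose digits add up to less than \<open>b\<close> is multiplied by a number \<open>\<rho>\<close> with digits \<open>0\<close> and \<open>1\<close>,
  no carries occur, so the digits of the product are the convolution of the digits of the
  factors, and reversal acts on the factors separately (\<open>digit_reversal_two_digit_mult\<close>).
  For a palindrome \<open>\<rho>\<close> the reversal of \<open>2p\<^sup>2\<rho>\<close> is therefore \<open>p\<^sup>4\<rho>\<close>.

  It remains to compare \<open>v\<close> on the two numbers. The lowest digit of \<open>\<rho>\<close> is \<open>1\<close> and \<open>b\<close> is even,
  so \<open>\<rho>\<close> is odd, and the factor \<open>2\<close> of \<open>2p\<^sup>2\<rho>\<close> adds exactly \<open>2\<close> to \<open>v\<close>. This makes up for
  the exponent of \<open>p\<close>, which is larger by \<open>2\<close> in \<open>p\<^sup>4\<rho>\<close>; the other prime factors agree. Here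
  \<open>\<rho>\<close> may well be divisible by \<open>p\<close>: both exponents of \<open>p\<close> are at least \<open>2\<close> and move together.
\<close>

lemma base_digits_properties:
  assumes "2 \<le> b" and "0 < n"
  shows "base_digits b n \<noteq> []" and "\<And>a. a \<in> set (base_digits b n) \<Longrightarrow> a < b"
    and "last (base_digits b n) \<noteq> 0" and "horner_sum id b (base_digits b n) = n"
  using base_digits_iff[OF assms, of "base_digits b n"] by auto

text \<open>The lowest digit of a reversal is the leading digit of the original number.\<close>

lemma not_dvd_digit_reversal:
  assumes "2 \<le> b" and "0 < n"
  shows "\<not> b dvd digit_reversal b n"
proof -
  let ?ds = "base_digits b n"
  note ds = base_digits_properties[OF assms]
  have "rev ?ds = last ?ds # rev (butlast ?ds)"
    using ds(1) by (metis append_butlast_last_id rev_eq_Cons_iff rev_rev_ident)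
  then have "digit_reversal b n mod b = last ?ds mod b"
    unfolding digit_reversal_def by (subst \<open>rev ?ds = _\<close>) simp
  also have "\<dots> = last ?ds"
    using ds(1,2) by simp
  finally show ?thesis
    using ds(3) by (simp add: mod_eq_0_iff_dvd[symmetric])
qed

lemma mod_base_in_base_digits:
  assumes "2 \<le> b" and "0 < n"
  shows "n mod b \<in> set (base_digits b n)"
  using assms by (subst base_digits.simps) simp

lemma horner_sum_map2_linear:
  fixes b c d :: "'a :: comm_semiring_0"
  assumes "length xs = length ys"
  shows "horner_sum id b (map2 (\<lambda>x y. c * x + d * y) xs ys) =
    c * horner_sum id b xs + d * horner_sum id b ys"
  using assms by (induction xs ys rule: list_induct2) (simp_all add: algebra_simps)

lemma horner_sum_snoc_zero: "horner_sum id b (xs @ [0]) = horner_sum id b xs"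
  by (induction xs) simp_all

text \<open>
  The digit of \<open>(c + d b) n\<close> at a given place is \<open>c x + d y\<close>, with \<open>x\<close> the digit of \<open>n\<close> at that
  place and \<open>y\<close> the one below it. As \<open>x\<close> and \<open>y\<close> are at most \<open>1\<close>, this is at most \<open>c + d\<close>,
  so nothing is carried. Reversing the digit list of the product reverses the two shifted copies
  of the digits of \<open>n\<close> and exchanges their shifts, so that \<open>c\<close> and \<open>d\<close> change places.
\<close>

lemma digit_reversal_two_digit_mult:
  assumes "c + d < b" and "0 < d" and "0 < n" and "2 \<le> b" and "digits_zero_one b n"
  shows "digit_reversal b ((c + d * b) * n) = (d + c * b) * digit_reversal b n"
proof -
  define ds where "ds = base_digits b n"
  define f where "f = (\<lambda>x y :: nat. c * x + d * y)"
  define es where "es = map2 f (ds @ [0]) (0 # ds)"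
  note ds = base_digits_properties[OF assms(4,3), folded ds_def]
  have ds01: "a \<le> 1" if "a \<in> set ds" for a
    using assms(5) that by (auto simp: digits_zero_one_def ds_def)
  have "e < b" if e: "e \<in> set es" for e
  proof -
    obtain x y where xy: "e = f x y" "(x, y) \<in> set (zip (ds @ [0]) (0 # ds))"
      using e unfolding es_def by auto
    have "x \<in> set (ds @ [0])" "y \<in> set (0 # ds)"
      using set_zip_leftD[OF xy(2)] set_zip_rightD[OF xy(2)] by blast+
    then have "x \<le> 1" "y \<le> 1"
      using ds01 by auto
    then have "c * x + d * y \<le> c * 1 + d * 1"
      by (intro add_mono mult_le_mono2)
    then show ?thesis
      using xy(1) assms(1) by (simp add: f_def)
  qed
  moreover have "last es \<noteq> 0"
  proof -
    have "last (zip (ds @ [0]) (0 # ds)) = (0, last ds)"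
      using ds(1) by (subst last_zip) simp_all
    moreover have "zip (ds @ [0]) (0 # ds) \<noteq> []"
      by (cases ds) simp_all
    ultimately have "last es = d * last ds"
      by (simp add: es_def last_map f_def)
    then show ?thesis
      using assms(2) ds(3) by simp
  qed
  moreover have "es \<noteq> []"
    by (cases ds) (simp_all add: es_def)
  moreover have "horner_sum id b es = (c + d * b) * n"
    unfolding es_def f_def using ds(4)
    by (subst horner_sum_map2_linear) (simp_all add: horner_sum_snoc_zero algebra_simps)
  moreover have "0 < (c + d * b) * n"
    using assms(2-4) by simp
  ultimately have "base_digits b ((c + d * b) * n) = es"
    using assms(4) by (subst base_digits_iff) auto
  moreover have "rev es = map2 f (0 # rev ds) (rev ds @ [0])"
    unfolding es_def rev_map by (subst zip_rev[symmetric]) simp_all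
  ultimately have "digit_reversal b ((c + d * b) * n) =
      horner_sum id b (map2 f (0 # rev ds) (rev ds @ [0]))"
    by (simp add: digit_reversal_def)
  also have "\<dots> = (d + c * b) * digit_reversal b n"
    unfolding f_def digit_reversal_def ds_def[symmetric]
    by (subst horner_sum_map2_linear) (simp_all add: horner_sum_snoc_zero algebra_simps)
  finally show ?thesis .
qed

lemma v_mult_coprime:
  assumes "coprime m n" and "0 < m" and "0 < n"
  shows "v (m * n) = v m + v n"
proof -
  have disj: "prime_factors m \<inter> prime_factors n = {}"
    using assms(1) by (auto simp: in_prime_factors_iff dest: coprime_common_divisor)
  have left: "multiplicity q (m * n) = multiplicity q m" if "q \<in> prime_factors m" for q
  proof -
    have "\<not> q dvd n" "prime_elem q"
      using that disj assms(3) by (auto simp: in_prime_factors_iff disjoint_iff)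
    then show ?thesis
      using assms(2,3) by (simp add: prime_elem_multiplicity_mult_distrib not_dvd_imp_multiplicity_0)
  qed
  have right: "multiplicity q (m * n) = multiplicity q n" if "q \<in> prime_factors n" for q
  proof -
    have "\<not> q dvd m" "prime_elem q"
      using that disj assms(2) by (auto simp: in_prime_factors_iff disjoint_iff)
    then show ?thesis
      using assms(2,3) by (simp add: prime_elem_multiplicity_mult_distrib not_dvd_imp_multiplicity_0)
  qed
  have "prime_factors (m * n) = prime_factors m \<union> prime_factors n"
    using assms(2,3) by (simp add: prime_factors_product)
  then show ?thesis
    using disj unfolding v_def
    by (simp add: sum.union_disjoint left right cong: sum.cong if_cong)
qed

lemma v_prime: "prime q \<Longrightarrow> v q = q"
  by (simp add: v_def prime_prime_factors)

lemma v_prime_power: "prime q \<Longrightarrow> 2 \<le> k \<Longrightarrow> v (q ^ k) = q + k"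
  by (simp add: v_def prime_factorization_prime_power)

text \<open>
  This rests on \<open>2 + (p + (k + 2)) = p + (k + 4)\<close>, where \<open>k\<close> is the exponent of \<open>p\<close> in \<open>n\<close>.
  Oddness of \<open>n\<close> keeps the exponent of \<open>2\<close> at one, where \<open>v\<close> does not count it.
\<close>

lemma v_two_times_square_mult:
  assumes "prime p" and "odd p" and "odd n"
  shows "v (2 * p\<^sup>2 * n) = v (p ^ 4 * n)"
proof -
  have "0 < n"
    using assms(3) by (rule odd_pos)
  then obtain k m where n: "n = p ^ k * m" and "\<not> p dvd m"
    using multiplicity_decompose'[of n p] assms(1) by (metis not_gr_zero not_prime_unit)
  have m: "0 < m" "odd m" "coprime p m"
    using assms n \<open>\<not> p dvd m\<close> \<open>0 < n\<close> by (auto simp: prime_imp_coprime)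
  have p: "0 < p"
    using assms(1) by (rule prime_gt_0_nat)
  have "v (2 * p\<^sup>2 * n) = v (2 * (p ^ (k + 2) * m))"
    by (simp add: n power_add power2_eq_square algebra_simps)
  also have "\<dots> = 2 + v (p ^ (k + 2) * m)"
    using assms(2) m p by (subst v_mult_coprime) (simp_all add: v_prime)
  also have "\<dots> = p + (k + 4) + v m"
    using assms(1) m p by (subst v_mult_coprime) (simp_all add: v_prime_power del: power_Suc)
  also have "\<dots> = v (p ^ (k + 4) * m)"
    using assms(1) m p by (subst v_mult_coprime) (simp_all add: v_prime_power del: power_Suc)
  also have "\<dots> = v (p ^ 4 * n)"
    by (simp add: n power_add algebra_simps)
  finally show ?thesis .
qed

theorem theorem12:
  fixes p \<rho> :: nat
  assumes "prime p" and "odd p"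
    and "palindrome (p\<^sup>2 + 1) \<rho>"
    and "digits_zero_one (p\<^sup>2 + 1) \<rho>"
  shows "2 * p\<^sup>2 * \<rho> \<in> v_palindromes (p\<^sup>2 + 1)"
proof -
  define b where "b = p\<^sup>2 + 1"
  have "3 \<le> p"
    using assms(1,2) by (metis One_nat_def Suc_leI even_numeral le_neq_implies_less
        numeral_2_eq_2 numeral_3_eq_3 prime_ge_2_nat)
  then have "9 \<le> p\<^sup>2"
    using power_mono[of 3 p 2] by simp
  then have b: "10 \<le> b"
    by (simp add: b_def)
  have \<rho>: "0 < \<rho>" "digit_reversal b \<rho> = \<rho>"
    using assms(3) by (simp_all add: palindrome_def b_def)
  have two_p2: "2 * p\<^sup>2 = (b - 2) + 1 * b"
    using b by (simp add: b_def)
  have "p ^ 4 = p\<^sup>2 * p\<^sup>2"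
    by (simp flip: power_add)
  also have "\<dots> = 1 + (b - 2) * b"
    using \<open>9 \<le> p\<^sup>2\<close> by (cases "p\<^sup>2") (auto simp: b_def)
  finally have p4: "p ^ 4 = 1 + (b - 2) * b" .
  have rev: "digit_reversal b (2 * p\<^sup>2 * \<rho>) = p ^ 4 * \<rho>"
    unfolding two_p2 p4
    using digit_reversal_two_digit_mult[of "b - 2" 1 b \<rho>] assms(4) b \<rho> by (simp add: b_def)
  \<comment> \<open>As \<open>2p\<^sup>2\<rho>\<close> is in turn the reversal of \<open>p\<^sup>4\<rho>\<close>, its lowest digit is a leading digit.\<close>
  have "\<not> b dvd 2 * p\<^sup>2 * \<rho>"
  proof -
    have "digit_reversal b (p ^ 4 * \<rho>) = 2 * p\<^sup>2 * \<rho>"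
      unfolding two_p2 p4
      using digit_reversal_two_digit_mult[of 1 "b - 2" b \<rho>] assms(4) b \<rho>
      by (simp add: b_def)
    then show ?thesis
      using not_dvd_digit_reversal[of b "p ^ 4 * \<rho>"] b \<rho>(1) \<open>3 \<le> p\<close> by simp
  qed
  moreover have "2 * p\<^sup>2 * \<rho> \<noteq> p ^ 4 * \<rho>"
  proof -
    have "2 * p\<^sup>2 < p\<^sup>2 * p\<^sup>2"
      using \<open>9 \<le> p\<^sup>2\<close> by (intro mult_strict_right_mono) linarith+
    then show ?thesis
      using \<rho>(1) by (simp add: power_add[of p 2 2, simplified])
  qed
  moreover have "odd \<rho>"
  proof -
    have "\<rho> mod b \<in> {0, 1}"
      using mod_base_in_base_digits[of b \<rho>] assms(4) b \<rho>(1)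
      by (auto simp: digits_zero_one_def b_def)
    moreover have "\<rho> mod b \<noteq> 0"
      using not_dvd_digit_reversal[of b \<rho>] b \<rho> by (simp add: mod_eq_0_iff_dvd)
    ultimately have "\<rho> mod b = 1"
      by simp
    moreover have "even b"
      using assms(2) by (simp add: b_def)
    ultimately show ?thesis
      by (metis dvd_mod_iff odd_one)
  qed
  ultimately show ?thesis
    using v_two_times_square_mult[OF assms(1,2)] rev \<rho>(1) \<open>3 \<le> p\<close>
    by (simp add: v_palindromes_def b_def)
qed

end
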